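(* Let $L$ be a finite lattice and $V:L\to L$ a closure operator. Identify the Bruns-Lakser completion $\mathsf{BL}(L)$ with $\mathcal O(\mathcal J(L))$, the poset of downsets of the poset of join-irreducible elements of $L$, ordered by inclusion. Define $\mathbf V:\mathsf{BL}(L)\to\mathsf{BL}(L)$ by $\mathbf V(X)=\bigcup_{x\in X}\widehat{V(x)}$, where $\widehat z=\{y\in\mathcal J(L):y\le z\}$ for $z\in L$. Then $\mathbf V$ is a closure operator.
   Context: An element $x$ of a lattice $L$ with bottom $\bot$ is join-irreducible if $x\neq\bot$ and $a\vee b=x$ implies $a=x$ or $b=x$; $\mathcal J(L)$ is the subposet of join-irreducible elements. A downset of a poset $P$ is a subset $A$ such that $y\le x\in A$ implies $y\in A$; $\mathcal O(P)$ is the set of downsets of $P$ ordered by inclusion. For a finite lattice $L$, the Bruns-Lakser completion $\mathsf{BL}(L)$ is taken to be $\mathcal O(\mathcal J(L))$. A closure operator on a poset $P$ is an order-preserving function $f:P\to P$ with $p\le f(p)$ and $f(f(p))=f(p)$ for all $p\in P$. *)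

theory Defs
  imports Main "HOL-Library.FuncSet"
begin

definition join_irreducible :: "'a::bounded_lattice_bot \<Rightarrow> bool" where
  "join_irreducible x \<longleftrightarrow> x \<noteq> bot \<and> (\<forall>a b. sup a b = x \<longrightarrow> a = x \<or> b = x)"

definition join_irreducibles :: "'a::bounded_lattice_bot set" where
  "join_irreducibles = {x. join_irreducible x}"

text \<open>Posets are carrier sets inside an ordered type, with the induced order. For the poset of
  downsets below this is a set of sets, ordered by inclusion.\<close>

definition downsets :: "'a::order set \<Rightarrow> 'a set set" where
  "downsets P = {A. A \<subseteq> P \<and> (\<forall>x\<in>A. \<forall>y\<in>P. y \<le> x \<longrightarrow> y \<in> A)}"

text \<open>This agrees with the Bruns-Lakser completion of a finite lattice only; it is not meant for
  infinite lattices.\<close>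

definition bruns_lakser :: "'a::{finite,bounded_lattice_bot} set set" where
  "bruns_lakser = downsets join_irreducibles"

definition closure_operator_on :: "'a::order set \<Rightarrow> ('a \<Rightarrow> 'a) \<Rightarrow> bool" where
  "closure_operator_on P f \<longleftrightarrow>
     f \<in> P \<rightarrow> P \<and> mono_on P f \<and> (\<forall>p\<in>P. p \<le> f p) \<and> (\<forall>p\<in>P. f (f p) = f p)"

definition ji_below :: "'a::bounded_lattice_bot \<Rightarrow> 'a set" where
  "ji_below z = {y \<in> join_irreducibles. y \<le> z}"

definition BL_lift :: "('a::bounded_lattice_bot \<Rightarrow> 'a) \<Rightarrow> 'a set \<Rightarrow> 'a set" where
  "BL_lift V X = (\<Union>x\<in>X. ji_below (V x))"

end

theory Submission
  imports Defs
begin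

text \<open>On downsets of join-irreducibles, the lift sends \<open>X\<close> to the join-irreducibles \<open>y\<close> with
  \<open>y \<le> V x\<close> for some \<open>x \<in> X\<close>. Monotonicity is then immediate from the union, and extensiveness of
  \<open>V\<close> puts every \<open>x \<in> X\<close> below its own witness \<open>V x\<close>. For idempotence, chaining two steps
  \<open>y \<le> V z\<close> and \<open>z \<le> V x\<close> gives \<open>y \<le> V (V x) = V x\<close>, so the second step adds nothing. That the lift
  lands in the downsets is transitivity of the order.\<close>

lemma BL_lift_in_downsets: "BL_lift V X \<in> downsets join_irreducibles"
  unfolding BL_lift_def ji_below_def downsets_def by (auto intro: order_trans)

lemma BL_lift_mono: "X \<subseteq> Y \<Longrightarrow> BL_lift V X \<subseteq> BL_lift V Y"
  unfolding BL_lift_def by blast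

lemma BL_lift_extensive:
  assumes "\<And>x. x \<le> V x" and "X \<subseteq> join_irreducibles"
  shows "X \<subseteq> BL_lift V X"
  using assms unfolding BL_lift_def ji_below_def by auto

lemma BL_lift_twice_subset:
  assumes "mono V" and idem: "\<And>x. V (V x) = V x"
  shows "BL_lift V (BL_lift V X) \<subseteq> BL_lift V X"
proof
  fix y assume "y \<in> BL_lift V (BL_lift V X)"
  then obtain z x where x: "x \<in> X" and zx: "z \<le> V x" and yz: "y \<le> V z"
    and y: "y \<in> join_irreducibles"
    unfolding BL_lift_def ji_below_def by blast
  have "V z \<le> V x" using monoD[OF \<open>mono V\<close> zx] by (simp add: idem)
  with yz have "y \<le> V x" by (rule order_trans)
  with x y show "y \<in> BL_lift V X" unfolding BL_lift_def ji_below_def by blast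
qed

theorem proposition8p7:
  fixes V :: "'a::{finite,bounded_lattice_bot} \<Rightarrow> 'a"
  assumes "closure_operator_on UNIV V"
  shows "closure_operator_on bruns_lakser (BL_lift V)"
proof -
  have mono: "mono V" and ext: "\<And>x. x \<le> V x" and idem: "\<And>x. V (V x) = V x"
    using assms unfolding closure_operator_on_def by auto
  have extensive: "X \<subseteq> BL_lift V X" if "X \<in> bruns_lakser" for X
    using BL_lift_extensive[OF ext] that unfolding bruns_lakser_def downsets_def by blast
  have closed: "BL_lift V X \<in> bruns_lakser" for X
    unfolding bruns_lakser_def by (rule BL_lift_in_downsets)
  have "BL_lift V (BL_lift V X) = BL_lift V X" for X
    using BL_lift_twice_subset[OF mono idem] extensive[OF closed] by (rule subset_antisym)
  then show ?thesis
    unfolding closure_operator_on_def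
    using closed extensive by (auto intro!: mono_onI dest: BL_lift_mono)
qed

end
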